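(* Let $r > 1$ and $c \ge 1$ be integers and let $W$ be an $r \times c$ storage area whose open side is its bottom (front) row. Then the following are equivalent: (i) for every number of loads $n \le rc$ and every arrival sequence $A$ (a permutation of $\{1,\dots,n\}$), with departure sequence $D = (1,\dots,n)$, there is a solution that avoids relocations, i.e. a sequence of exactly $2n$ actions that first stores all loads in the order $A$ and then retrieves them in the order $D$, without any relocation; (ii) $c \ge 3$.
   Context: Storage area: a rectangular grid $W$ with $r$ rows and $c$ columns; the bottom row (front row) is the only side through which loads enter and leave. There are $n \le rc$ loads with distinct labels $1,\dots,n$, each occupying exactly one cell; no two loads share a cell. A load moves only along paths of horizontally/vertically adjacent cells (moves up, down, left, right) that are currently empty (apart from the load's own starting cell). Actions: (Storage) an arriving load is placed in an empty cell $v$ via a path from any cell of the front row to $v$. (Retrieval) a load is removed via a path from its current cell to any cell of the front row. (Relocation) a load is moved inside $W$ from its current cell to an empty cell $v$ via a path, where $v$ and the original cell must be accessible from the front row. Loads arrive one at a time in the order $A=(a_1,\dots,a_n)$, each being stored before the next arrives; after all are stored, they are retrieved in the order of the departure sequence $D$, which is fixed to be $(1,\dots,n)$ by relabeling. Offline setting: both $A$ and $D$ are known in advance. *)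

theory Defs
  imports Main
begin

text \<open>A cell is a pair (row, column); rows are counted from the front, so row 0 is the open side.\<close>

type_synonym cell = "nat \<times> nat"
type_synonym config = "cell \<Rightarrow> nat option"

definition grid :: "nat \<Rightarrow> nat \<Rightarrow> cell set" where
  "grid r c = {..<r} \<times> {..<c}"

definition front :: "nat \<Rightarrow> nat \<Rightarrow> cell set" where
  "front r c = {v \<in> grid r c. fst v = 0}"

fun adjacent :: "cell \<Rightarrow> cell \<Rightarrow> bool" where
  "adjacent (i, j) (i', j') \<longleftrightarrow>
     (i = i' \<and> (j' = Suc j \<or> j = Suc j')) \<or> (j = j' \<and> (i' = Suc i \<or> i = Suc i'))"

definition empty_path :: "nat \<Rightarrow> nat \<Rightarrow> config \<Rightarrow> cell \<Rightarrow> cell list \<Rightarrow> cell \<Rightarrow> bool" where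
  "empty_path r c C u p v \<longleftrightarrow>
     p \<noteq> [] \<and> hd p = u \<and> last p = v \<and> set p \<subseteq> grid r c \<and>
     successively adjacent p \<and> (\<forall>x \<in> set p. C x = None)"

definition accessible :: "nat \<Rightarrow> nat \<Rightarrow> config \<Rightarrow> cell \<Rightarrow> bool" where
  "accessible r c C v \<longleftrightarrow> (\<exists>f \<in> front r c. \<exists>p. empty_path r c C f p v)"

datatype action = Store nat cell | Retrieve nat | Relocate nat cell

text \<open>A load may use its own cell when it leaves it, so the paths of a load currently in cell \<open>u\<close>
  are taken in the configuration \<open>C(u := None)\<close>.\<close>

inductive step :: "nat \<Rightarrow> nat \<Rightarrow> config \<Rightarrow> action \<Rightarrow> config \<Rightarrow> bool" for r c where
  store:
    "\<lbrakk>f \<in> front r c; empty_path r c C f p v\<rbrakk>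
     \<Longrightarrow> step r c C (Store l v) (C(v \<mapsto> l))"
| retrieve:
    "\<lbrakk>C u = Some l; f \<in> front r c; empty_path r c (C(u := None)) u p f\<rbrakk>
     \<Longrightarrow> step r c C (Retrieve l) (C(u := None))"
| relocate:
    "\<lbrakk>C u = Some l; C v = None; empty_path r c (C(u := None)) u p v;
      accessible r c (C(u := None)) u; accessible r c (C(u := None)) v\<rbrakk>
     \<Longrightarrow> step r c C (Relocate l v) (C(u := None, v \<mapsto> l))"

fun run :: "nat \<Rightarrow> nat \<Rightarrow> config \<Rightarrow> action list \<Rightarrow> config \<Rightarrow> bool" where
  "run r c C [] C' \<longleftrightarrow> C' = C"
| "run r c C (a # as) C' \<longleftrightarrow> (\<exists>C1. step r c C a C1 \<and> run r c C1 as C')"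

fun stored :: "action list \<Rightarrow> nat list" where
  "stored [] = []"
| "stored (Store l v # as) = l # stored as"
| "stored (Retrieve l # as) = stored as"
| "stored (Relocate l v # as) = stored as"

fun retrieved :: "action list \<Rightarrow> nat list" where
  "retrieved [] = []"
| "retrieved (Store l v # as) = retrieved as"
| "retrieved (Retrieve l # as) = l # retrieved as"
| "retrieved (Relocate l v # as) = retrieved as"

fun is_relocation :: "action \<Rightarrow> bool" where
  "is_relocation (Relocate l v) \<longleftrightarrow> True"
| "is_relocation _ \<longleftrightarrow> False"

text \<open>Relocations may occur anywhere in a solution, both while loads are being stored (\<open>S\<close>) and
  while they are being retrieved (\<open>R\<close>).\<close>

definition solution :: "nat \<Rightarrow> nat \<Rightarrow> nat list \<Rightarrow> nat list \<Rightarrow> action list \<Rightarrow> bool" where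
  "solution r c A D as \<longleftrightarrow>
     run r c Map.empty as Map.empty \<and>
     (\<exists>S R. as = S @ R \<and> stored S = A \<and> retrieved S = [] \<and> stored R = [] \<and> retrieved R = D)"

definition relocation_free :: "action list \<Rightarrow> bool" where
  "relocation_free as \<longleftrightarrow> (\<forall>a \<in> set as. \<not> is_relocation a)"

end

theory Submission
  imports Defs
begin

text \<open>Give every load the key \<open>s\<close>, decreasing in the order of arrival. An assignment of loads to cells
  can be realized without relocations as soon as every cell outside the front row has a neighbour
  with a smaller label (the way out at retrieval) and a neighbour with a smaller key (the way in at
  storage): following such neighbours leads to the front through cells that are empty at that time.

  For three columns such an assignment is found greedily from the front to the back. Each row of the
  first two columns receives the smallest label and the smallest key among the remaining loads,
  which support each other. This is impossible only if one load minimizes both; such loads are put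
  into the third column, where they form a chain increasing in label and key. If the third column
  is already ahead, its entry supports the pair next to it. The loads left over at the end have
  larger keys than the second column, so they fill up the third column in the order of their labels.\<close>

section \<open>Fillings\<close>

lemma adjacent_sym: "adjacent v w \<longleftrightarrow> adjacent w v"
  by (cases v; cases w) auto

text \<open>Departures follow the order of \<open>'a\<close> itself and \<open>s\<close> is the key,
  so the first conjunct prepares the way out and the second the way in. Witnesses are confined to
  \<open>D\<close>, the cells filled so far, which lets a filling grow step by step.\<close>

definition supported ::
    "('a::linorder \<Rightarrow> 'b::linorder) \<Rightarrow> cell set \<Rightarrow> (cell \<Rightarrow> 'a) \<Rightarrow> cell \<Rightarrow> bool" where
  "supported s D g v \<longleftrightarrow> fst v = 0 \<or>
     (\<exists>w \<in> D. adjacent v w \<and> g w < g v) \<and> (\<exists>w \<in> D. adjacent v w \<and> s (g w) < s (g v))"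

definition filling ::
    "('a::linorder \<Rightarrow> 'b::linorder) \<Rightarrow> cell set \<Rightarrow> 'a set \<Rightarrow> (cell \<Rightarrow> 'a) \<Rightarrow> bool" where
  "filling s D X g \<longleftrightarrow> bij_betw g D X \<and> (\<forall>v \<in> D. supported s D g v)"

text \<open>Old cells keep their witnesses, which lie in \<open>D\<close> and retain their values;
  only new cells have to be checked.\<close>

lemma filling_extend:
  assumes "filling s D A g" "D \<subseteq> D'" "bij_betw g' D' A'" "\<And>v. v \<in> D \<Longrightarrow> g' v = g v"
    and "\<And>v. v \<in> D' - D \<Longrightarrow> supported s D' g' v"
  shows "filling s D' A' g'"
proof -
  have "supported s D' g' v" if "v \<in> D" for v
  proof -
    have "supported s D g v"
      using assms(1) that by (auto simp: filling_def)
    then show ?thesis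
      using that assms(2,4) unfolding supported_def by (metis subsetD)
  qed
  then show ?thesis
    using assms(3,5) by (auto simp: filling_def)
qed

lemma bij_betw_insert_upd:
  assumes "bij_betw g D A" "v \<notin> D" "y \<notin> A"
  shows "bij_betw (g(v := y)) (insert v D) (insert y A)"
proof -
  have "bij_betw (g(v := y)) D A"
    using assms(1,2) by (subst bij_betw_cong[of _ _ g]) auto
  then show ?thesis
    using notIn_Un_bij_betw[of v D "g(v := y)" A] assms by simp
qed

lemma filling_insert:
  assumes "filling s D A g" "v \<notin> D" "y \<notin> A" "supported s (insert v D) (g(v := y)) v"
  shows "filling s (insert v D) (insert y A) (g(v := y))"
proof (rule filling_extend[OF assms(1)])
  show "bij_betw (g(v := y)) (insert v D) (insert y A)"
    using assms by (intro bij_betw_insert_upd) (auto simp: filling_def)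
qed (use assms in auto)

text \<open>The loads of \<open>U\<close> enter the column in increasing order of label: the cell in
  front then has a smaller label, and the left neighbour has a smaller key by hypothesis. The case
  \<open>0 < m\<close> completes a column that is already begun.\<close>

lemma filling_column:
  assumes "filling s D A g" "finite U" "A \<inter> U = {}" "card U = r - m" "m \<le> r"
    and "D \<inter> {m..<r} \<times> {Suc j} = {}"
    and "\<And>i u. i \<in> {m..<r} \<Longrightarrow> u \<in> U \<Longrightarrow> (i, j) \<in> D \<and> s (g (i, j)) < s u"
    and "\<And>u. 0 < m \<Longrightarrow> u \<in> U \<Longrightarrow> (m - 1, Suc j) \<in> D \<and> g (m - 1, Suc j) < u"
  shows "\<exists>g'. filling s (D \<union> {m..<r} \<times> {Suc j}) (A \<union> U) g'"
  using assms
proof (induction "r - m" arbitrary: m D A U g)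
  case 0
  then have "U = {}" "{m..<r} = {}"
    by auto
  then show ?case
    using "0.prems"(1) by auto
next
  case (Suc k)
  define y where "y = Min U"
  define v where "v = (m, Suc j)"
  let ?g = "g(v := y)"
  have mr: "m < r"
    using Suc.hyps(2) by simp
  have "U \<noteq> {}"
    using Suc.prems(4) mr by auto
  then have y: "y \<in> U" and y_min: "\<And>u. u \<in> U - {y} \<Longrightarrow> y < u"
    using Suc.prems(2) by (auto simp: y_def order_neq_le_trans)
  have v: "v \<notin> D"
    using Suc.prems(6) mr by (auto simp: v_def)
  have left: "(m, j) \<in> D \<and> s (g (m, j)) < s y"
    using Suc.prems(7)[of m y] mr y by simp
  have supp: "supported s (insert v D) ?g v"
  proof (cases "m = 0")
    case False
    then have "(m - 1, Suc j) \<in> D \<and> g (m - 1, Suc j) < y"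
      using Suc.prems(8)[of y] y by simp
    moreover have "adjacent v (m - 1, Suc j)" "adjacent v (m, j)"
        "(m - 1, Suc j) \<noteq> v" "(m, j) \<noteq> v"
      using False by (auto simp: v_def)
    ultimately show ?thesis
      using left unfolding supported_def by (metis fun_upd_apply insertCI)
  qed (simp add: supported_def v_def)
  have "\<exists>g'. filling s (insert v D \<union> {Suc m..<r} \<times> {Suc j}) (insert y A \<union> (U - {y})) g'"
  proof (rule Suc.hyps(1))
    show "filling s (insert v D) (insert y A) ?g"
      using Suc.prems(1,3) v y supp by (intro filling_insert) auto
    show "insert v D \<inter> {Suc m..<r} \<times> {Suc j} = {}"
      using Suc.prems(6) by (auto simp: v_def)
    show "(i, j) \<in> insert v D \<and> s (?g (i, j)) < s u"
      if "i \<in> {Suc m..<r}" "u \<in> U - {y}" for i u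
      using Suc.prems(7)[of i u] that by (auto simp: v_def)
    show "(Suc m - 1, Suc j) \<in> insert v D \<and> ?g (Suc m - 1, Suc j) < u"
      if "u \<in> U - {y}" for u
      using y_min[OF that] by (simp add: v_def)
  qed (use Suc.prems Suc.hyps(2) y mr in auto)
  moreover have "insert v D \<union> {Suc m..<r} \<times> {Suc j} = D \<union> {m..<r} \<times> {Suc j}"
    using mr by (auto simp: v_def)
  moreover have "insert y A \<union> (U - {y}) = A \<union> U"
    using y by auto
  ultimately show ?case
    by simp
qed

section \<open>The greedy filling of three columns\<close>

definition region :: "nat \<Rightarrow> nat \<Rightarrow> cell set" where
  "region h m = {..<h} \<times> {0, 1} \<union> {..<m} \<times> {2}"

text \<open>\<open>U\<close> holds the loads not yet placed. A pair consists of a label minimum on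
  the left and a key minimum on the right, so column 0 can only promise smaller labels and column 1
  smaller keys; column 2 promises both.\<close>

definition stage ::
    "('a::linorder \<Rightarrow> 'b::linorder) \<Rightarrow> 'a set \<Rightarrow> nat \<Rightarrow> nat \<Rightarrow> (cell \<Rightarrow> 'a) \<Rightarrow> 'a set \<Rightarrow> bool" where
  "stage s X h m g U \<longleftrightarrow> U \<subseteq> X \<and> filling s (region h m) (X - U) g \<and>
     (\<forall>u \<in> U. (\<forall>i < h. g (i, 0) < u \<and> s (g (i, 1)) < s u) \<and>
               (\<forall>i < m. g (i, 2) < u \<and> s (g (i, 2)) < s u))"

lemma card_region: "card (region h m) = 2 * h + m"
proof -
  have "card (region h m) = card ({..<h} \<times> {0, 1::nat}) + card ({..<m} \<times> {2::nat})"
    unfolding region_def by (rule card_Un_disjoint) auto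
  then show ?thesis
    by (simp add: card_cartesian_product)
qed

lemma stage_card:
  assumes "stage s X h m g U" "finite X"
  shows "card X = 2 * h + m + card U"
proof -
  have "card (X - U) = 2 * h + m"
    using assms(1) bij_betw_same_card card_region
    unfolding stage_def filling_def by metis
  moreover have "card (X - U) = card X - card U" "card U \<le> card X"
    using assms by (auto simp: stage_def card_Diff_subset card_mono finite_subset)
  ultimately show ?thesis
    by simp
qed

text \<open>The entry in front of the new one is below all remaining loads in both orders, so it
  alone gives both supports. Injectivity of \<open>s\<close> makes the new key strictly minimal,
  which preserves the invariant.\<close>

lemma stage_third_column:
  assumes "stage s X h m g U" "inj_on s X" "x \<in> U" and x_min: "\<And>u. u \<in> U \<Longrightarrow> x \<le> u \<and> s x \<le> s u"
  shows "stage s X h (Suc m) (g((m, 2) := x)) (U - {x})"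
proof -
  let ?g = "g((m, 2) := x)"
  have U: "U \<subseteq> X" and fill: "filling s (region h m) (X - U) g"
    and low: "\<And>u i. u \<in> U \<Longrightarrow> i < h \<Longrightarrow> g (i, 0) < u \<and> s (g (i, 1)) < s u"
      "\<And>u i. u \<in> U \<Longrightarrow> i < m \<Longrightarrow> g (i, 2) < u \<and> s (g (i, 2)) < s u"
    using assms(1) by (auto simp: stage_def)
  have x_less: "x < u \<and> s x < s u" if "u \<in> U - {x}" for u
    using x_min[of u] that inj_onD[OF assms(2), of x u] assms(3) U
    by (auto simp: order.order_iff_strict)
  have reg: "region h (Suc m) = insert (m, 2) (region h m)"
    by (auto simp: region_def)
  have supp: "supported s (insert (m, 2) (region h m)) ?g (m, 2)"
  proof (cases "m = 0")
    case False
    have "(m - 1, 2) \<in> region h m" "adjacent (m, 2) (m - 1, 2)" "(m - 1, 2) \<noteq> (m, 2::nat)"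
      using False by (auto simp: region_def)
    moreover have "g (m - 1, 2) < x \<and> s (g (m - 1, 2)) < s x"
      using low(2)[of x "m - 1"] False assms(3) by simp
    ultimately show ?thesis
      unfolding supported_def by (metis fun_upd_apply insertCI)
  qed (simp add: supported_def)
  have "filling s (insert (m, 2) (region h m)) (insert x (X - U)) ?g"
    using fill assms(3) supp by (intro filling_insert) (auto simp: region_def)
  moreover have "insert x (X - U) = X - (U - {x})"
    using assms(3) U by auto
  ultimately show ?thesis
    using U low x_less unfolding stage_def reg by (auto simp: less_Suc_eq)
qed

text \<open>In a pair \<open>p\<close>, \<open>q\<close> the left load \<open>p\<close> always has the larger key. If \<open>q < p\<close>, then \<open>q\<close> finds
  a smaller label in the third column.\<close>

lemma stage_pair:
  assumes "stage s X h m g U" "inj_on s X" "q \<in> U" "p \<in> U" "p \<noteq> q"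
    and q_min: "\<And>u. u \<in> U \<Longrightarrow> s q \<le> s u" and p_min: "\<And>u. u \<in> U - {q} \<Longrightarrow> p \<le> u"
    and "h < m \<or> p < q"
  shows "stage s X (Suc h) m (g((h, 0) := p, (h, 1) := q)) (U - {p, q})"
proof -
  let ?g = "g((h, 0) := p, (h, 1) := q)" and ?D = "insert (h, 1) (insert (h, 0) (region h m))"
  have U: "U \<subseteq> X" and fill: "filling s (region h m) (X - U) g"
    and low: "\<And>u i. u \<in> U \<Longrightarrow> i < h \<Longrightarrow> g (i, 0) < u \<and> s (g (i, 1)) < s u"
      "\<And>u i. u \<in> U \<Longrightarrow> i < m \<Longrightarrow> g (i, 2) < u \<and> s (g (i, 2)) < s u"
    using assms(1) by (auto simp: stage_def)
  have p_less: "p < u" if "u \<in> U - {p, q}" for u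
    using p_min[of u] that by (auto simp: order.order_iff_strict)
  have q_less: "s q < s u" if "u \<in> U - {q}" for u
    using q_min[of u] that inj_onD[OF assms(2), of q u] assms(3) U
    by (auto simp: order.order_iff_strict)
  have reg: "region (Suc h) m = ?D"
    by (auto simp: region_def)
  have notin: "(h, 0) \<notin> region h m" "(h, 1) \<notin> region h m"
    by (auto simp: region_def)
  have supp_p: "supported s ?D ?g (h, 0)"
  proof (cases "h = 0")
    case False
    then have "(h - 1, 0) \<in> ?D" "adjacent (h, 0) (h - 1, 0)" "?g (h - 1, 0) < ?g (h, 0)"
      using low(1)[of p "h - 1"] assms(4) by (auto simp: region_def)
    moreover have "(h, 1) \<in> ?D" "adjacent (h, 0) (h, 1)" "s (?g (h, 1)) < s (?g (h, 0))"
      using q_less[of p] assms(4,5) by auto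
    ultimately show ?thesis
      unfolding supported_def by blast
  qed (simp add: supported_def)
  have supp_q: "supported s ?D ?g (h, 1)"
  proof (cases "h = 0")
    case False
    then have "(h - 1, 1) \<in> ?D" "adjacent (h, 1) (h - 1, 1)" "s (?g (h - 1, 1)) < s (?g (h, 1))"
      using low(1)[of q "h - 1"] assms(3) by (auto simp: region_def)
    moreover have "\<exists>w \<in> ?D. adjacent (h, 1) w \<and> ?g w < ?g (h, 1)"
    proof (cases "h < m")
      case True
      then have "(h, 2) \<in> ?D" "adjacent (h, 1) (h, 2)" "?g (h, 2) < ?g (h, 1)"
        using low(2)[of q h] assms(3) by (auto simp: region_def)
      then show ?thesis
        by blast
    next
      case False
      then have "(h, 0) \<in> ?D" "adjacent (h, 1) (h, 0)" "?g (h, 0) < ?g (h, 1)"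
        using assms(8) by auto
      then show ?thesis
        by blast
    qed
    ultimately show ?thesis
      unfolding supported_def by blast
  qed (simp add: supported_def)
  \<comment> \<open>Both cells are added at once: \<open>(h, 0)\<close> may need
    \<open>(h, 1)\<close> for its key, and \<open>(h, 1)\<close> may need \<open>(h, 0)\<close> for
    its label.\<close>
  have "filling s ?D (insert q (insert p (X - U))) ?g"
  proof (rule filling_extend[OF fill])
    show "bij_betw ?g ?D (insert q (insert p (X - U)))"
      using fill assms(3-5) notin by (intro bij_betw_insert_upd) (auto simp: filling_def)
    show "supported s ?D ?g v" if "v \<in> ?D - region h m" for v
      using that supp_p supp_q by blast
  qed (use notin in auto)
  moreover have "insert q (insert p (X - U)) = X - (U - {p, q})"
    using assms(3,4) U by auto
  ultimately show ?thesis
    using U low p_less q_less unfolding stage_def reg by (auto simp: less_Suc_eq)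
qed

text \<open>\<open>N\<close> counts greedy steps. As long as \<open>h < r\<close>, each step raises
  \<open>h\<close> or \<open>m\<close> by one.\<close>

lemma ex_stage:
  assumes "finite X" "card X = r * 3" "inj_on s X"
  shows "\<exists>h m g U. stage s X h m g U \<and> h \<le> r \<and> m \<le> r \<and> m \<le> Suc h \<and> (h = r \<or> N \<le> h + m)"
proof (induction N)
  case 0
  have "stage s X 0 0 (\<lambda>_. undefined) X"
    by (simp add: stage_def filling_def region_def bij_betw_def)
  then show ?case
    by fastforce
next
  case (Suc N)
  then obtain h m g U where st: "stage s X h m g U" and le: "h \<le> r" "m \<le> r" "m \<le> Suc h"
    and N: "h = r \<or> N \<le> h + m"
    by blast
  show ?case
  proof (cases "h = r")
    case True
    then show ?thesis
      using st le by blast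
  next
    case False
    \<comment> \<open>There remain \<open>3 * r - 2 * h - m\<close> loads, at least 2 because
      \<open>m \<le> r\<close> and \<open>h < r\<close>; this is enough for a pair.\<close>
    have U: "finite U" "2 \<le> card U"
      using st assms stage_card[OF st assms(1)] le False
      by (auto simp: stage_def intro: finite_subset)
    then have "U \<noteq> {}"
      by auto
    define q where "q = arg_min_on s U"
    have q: "q \<in> U" "\<And>u. u \<in> U \<Longrightarrow> s q \<le> s u"
      using U \<open>U \<noteq> {}\<close> arg_min_if_finite[of U s] by (auto simp: q_def not_less)
    show ?thesis
    \<comment> \<open>If \<open>q\<close> has both the smallest key and the smallest label and the
      third column is not ahead, a pair could leave \<open>q\<close> without a smaller label beside
      it. Then \<open>q\<close> goes to the third column.\<close>
    proof (cases "m \<le> h \<and> (\<forall>u \<in> U. q \<le> u)")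
      case True
      then have "stage s X h (Suc m) (g((m, 2) := q)) (U - {q})"
        using stage_third_column[OF st assms(3) q(1)] q(2) by blast
      then show ?thesis
        using True le False N by fastforce
    next
      case *: False
      define p where "p = Min (U - {q})"
      have "card (U - {q}) \<noteq> 0"
        using U q(1) by simp
      then have "U - {q} \<noteq> {}"
        by force
      then have p: "p \<in> U - {q}" "\<And>u. u \<in> U - {q} \<Longrightarrow> p \<le> u"
        using U Min_in[of "U - {q}"] by (auto simp: p_def)
      have "h < m \<or> p < q"
      proof (cases "m \<le> h")
        case True
        then obtain u where "u \<in> U" "u < q"
          using * by (auto simp: not_le)
        then have "p \<le> u"
          using p(2)[of u] by blast
        then show ?thesis
          using \<open>u < q\<close> order_le_less_trans by blast
      qed simp
      then have "stage s X (Suc h) m (g((h, 0) := p, (h, 1) := q)) (U - {p, q})"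
        using stage_pair[OF st assms(3) q(1)] p q(2) by blast
      moreover have "Suc h \<le> r" "m \<le> Suc (Suc h)" "Suc N \<le> Suc h + m"
        using le False N by auto
      ultimately show ?thesis
        using le by blast
    qed
  qed
qed

lemma ex_filling_three:
  assumes "finite X" "card X = r * 3" "inj_on s X"
  shows "\<exists>g. filling s (grid r 3) X g"
proof -
  \<comment> \<open>\<open>N = 2 * r + 1\<close> exceeds every possible \<open>h + m\<close>, which
    forces \<open>h = r\<close>.\<close>
  obtain h m g U where st: "stage s X h m g U" and le: "h \<le> r" "m \<le> r" "m \<le> Suc h"
    and N: "h = r \<or> 2 * r + 1 \<le> h + m"
    using ex_stage[OF assms] by blast
  then have "h = r"
    by auto
  have U: "U \<subseteq> X" and fill: "filling s (region r m) (X - U) g"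
    and low: "\<And>u i. u \<in> U \<Longrightarrow> i < r \<Longrightarrow> g (i, 0) < u \<and> s (g (i, 1)) < s u"
      "\<And>u i. u \<in> U \<Longrightarrow> i < m \<Longrightarrow> g (i, 2) < u \<and> s (g (i, 2)) < s u"
    using st \<open>h = r\<close> by (auto simp: stage_def)
  have "\<exists>g'. filling s (region r m \<union> {m..<r} \<times> {Suc 1}) (X - U \<union> U) g'"
  proof (rule filling_column[OF fill])
    show "finite U"
      using U assms(1) finite_subset by blast
    show "card U = r - m"
      using stage_card[OF st assms(1)] assms(2) \<open>h = r\<close> by simp
  qed (use le low in \<open>auto simp: region_def numeral_2_eq_2\<close>)
  moreover have "region r m \<union> {m..<r} \<times> {Suc 1} = grid r 3"
    using le by (auto simp: region_def grid_def)
  moreover have "X - U \<union> U = X"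
    using U by auto
  ultimately show ?thesis
    by simp
qed

section \<open>More than three columns\<close>

lemma ex_upper_subset:
  fixes s :: "'a \<Rightarrow> 'b::linorder"
  assumes "finite X" "inj_on s X" "k \<le> card X"
  shows "\<exists>T \<subseteq> X. card T = k \<and> (\<forall>x \<in> X - T. \<forall>t \<in> T. s x < s t)"
  using assms(3)
proof (induction k)
  case (Suc k)
  then obtain T where T: "T \<subseteq> X" "card T = k" "\<forall>x \<in> X - T. \<forall>t \<in> T. s x < s t"
    by auto
  have fin: "finite (X - T)" and ne: "X - T \<noteq> {}"
    using assms(1) T Suc.prems by (auto simp: subset_antisym)
  have "Max (s ` (X - T)) \<in> s ` (X - T)"
    using fin ne by (intro Max_in) auto
  then obtain y where y: "y \<in> X - T" "s y = Max (s ` (X - T))"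
    by auto
  have "s x < s y" if "x \<in> X - insert y T" for x
  proof -
    have "s x \<le> s y"
      using that fin by (auto simp: y(2))
    moreover have "s x \<noteq> s y"
      using that y(1) inj_onD[OF assms(2), of x y] by auto
    ultimately show ?thesis
      by simp
  qed
  then show ?case
    using T y(1) assms(1) finite_subset[of T X]
    by (intro exI[of _ "insert y T"]) auto
qed auto

text \<open>Induction on \<open>c\<close>: the \<open>r\<close> loads with the largest keys, sorted by label, form the last column.
  Each has its left neighbour as support for the key and the load in front of it for the label.\<close>

lemma ex_filling:
  assumes "3 \<le> c" "finite X" "card X = r * c" "inj_on s X"
  shows "\<exists>g. filling s (grid r c) X g"
  using assms
proof (induction c arbitrary: X rule: dec_induct)
  case base
  then show ?case
    by (intro ex_filling_three)
next
  case (step c)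
  obtain T where T: "T \<subseteq> X" "card T = r" "\<forall>x \<in> X - T. \<forall>t \<in> T. s x < s t"
    using ex_upper_subset[OF step.prems(1,3), of r] step.prems(2) by auto
  have finT: "finite T"
    using T(1) step.prems(1) finite_subset by blast
  have "\<exists>g. filling s (grid r c) (X - T) g"
    using step.prems T finT
    by (intro step.IH) (auto simp: card_Diff_subset inj_on_diff)
  then obtain g where g: "filling s (grid r c) (X - T) g" ..
  have g_in: "g v \<in> X - T" if "v \<in> grid r c" for v
    using g that by (auto simp: filling_def bij_betw_def)
  obtain j where j: "c = Suc j"
    using step.hyps by (cases c) auto
  have "\<exists>g'. filling s (grid r c \<union> {0..<r} \<times> {Suc j}) (X - T \<union> T) g'"
  proof (rule filling_column[OF g finT])
    show "(i, j) \<in> grid r c \<and> s (g (i, j)) < s u" if "i \<in> {0..<r}" "u \<in> T" for i u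
      using that g_in[of "(i, j)"] T(3) by (auto simp: grid_def j)
  qed (use T in \<open>auto simp: grid_def j\<close>)
  moreover have "grid r c \<union> {0..<r} \<times> {Suc j} = grid r (Suc c)"
    by (auto simp: grid_def j)
  moreover have "X - T \<union> T = X"
    using T by auto
  ultimately show ?case
    by simp
qed

section \<open>From fillings to solutions\<close>

text \<open>Moving to neighbours of smaller key must stop, since keys are natural numbers, and it
  can stop only in the front row. All cells after \<open>v\<close> have keys below that of
  \<open>v\<close>.\<close>

lemma ex_descending_path:
  fixes key :: "cell \<Rightarrow> nat"
  assumes desc: "\<And>v. v \<in> grid r c \<Longrightarrow> fst v \<noteq> 0 \<Longrightarrow> \<exists>w \<in> grid r c. adjacent v w \<and> key w < key v"
    and "v \<in> grid r c"
  shows "\<exists>f \<in> front r c. \<exists>p. p \<noteq> [] \<and> hd p = v \<and> last p = f \<and> set p \<subseteq> grid r c \<and>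
    successively adjacent p \<and> (\<forall>x \<in> set p. x = v \<or> key x < key v)"
  using assms(2)
proof (induction v rule: measure_induct_rule[of key])
  case (less v)
  show ?case
  proof (cases "fst v = 0")
    case True
    then show ?thesis
      using less.prems by (intro bexI[of _ v] exI[of _ "[v]"]) (auto simp: front_def)
  next
    case False
    then obtain w where w: "w \<in> grid r c" "adjacent v w" "key w < key v"
      using desc[OF less.prems] by blast
    then obtain f p where "f \<in> front r c" "p \<noteq> []" "hd p = w" "last p = f" "set p \<subseteq> grid r c"
        "successively adjacent p" "\<forall>x \<in> set p. x = w \<or> key x < key w"
      using less.IH[of w] by blast
    then show ?thesis
      using w less.prems
      by (intro bexI[of _ f] exI[of _ "v # p"]) (fastforce simp: successively_Cons)+
  qed
qed

lemma successively_adjacent_rev: "successively adjacent (rev p) \<longleftrightarrow> successively adjacent p"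
proof -
  have "(\<lambda>v w. adjacent w v) = adjacent"
    using adjacent_sym by (intro ext) blast
  then show ?thesis
    by (simp only: successively_rev)
qed

lemma empty_path_rev: "empty_path r c C u p v \<Longrightarrow> empty_path r c C v (rev p) u"
  by (simp add: empty_path_def hd_rev last_rev successively_adjacent_rev
      del: successively_rev)

text \<open>Every load has one fixed cell given by \<open>g\<close>, so a state is determined by the
  set \<open>Y\<close> of loads present.\<close>

definition conf :: "nat \<Rightarrow> nat \<Rightarrow> (cell \<Rightarrow> nat) \<Rightarrow> nat set \<Rightarrow> config" where
  "conf r c g Y = (\<lambda>v. if v \<in> grid r c \<and> g v \<in> Y then Some (g v) else None)"

lemma conf_insert:
  assumes "inj_on g (grid r c)" "v \<in> grid r c"
  shows "(conf r c g Y)(v \<mapsto> g v) = conf r c g (insert (g v) Y)"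
  using assms by (auto simp: conf_def inj_on_def fun_eq_iff)

lemma conf_delete:
  assumes "inj_on g (grid r c)" "v \<in> grid r c" "g v \<notin> Y"
  shows "(conf r c g (insert (g v) Y))(v := None) = conf r c g Y"
  using assms by (auto simp: conf_def inj_on_def fun_eq_iff)

text \<open>The descending path meets only values below that of \<open>g v\<close>, whereas all
  loads present lie above it. With the arrival key as \<open>s\<close> this yields storage paths,
  with the identity retrieval paths.\<close>

lemma ex_empty_path_conf:
  fixes s :: "nat \<Rightarrow> nat"
  assumes desc: "\<And>v. v \<in> grid r c \<Longrightarrow> fst v \<noteq> 0 \<Longrightarrow> \<exists>w \<in> grid r c. adjacent v w \<and> s (g w) < s (g v)"
    and "v \<in> grid r c" "g v \<notin> Y" "\<And>y. y \<in> Y \<Longrightarrow> s (g v) < s y"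
  shows "\<exists>f \<in> front r c. \<exists>p. empty_path r c (conf r c g Y) v p f"
proof -
  obtain f p where f: "f \<in> front r c" and p: "p \<noteq> []" "hd p = v" "last p = f" "set p \<subseteq> grid r c"
      "successively adjacent p" "\<forall>x \<in> set p. x = v \<or> s (g x) < s (g v)"
    using ex_descending_path[of r c "\<lambda>v. s (g v)" v] assms(1,2) by blast
  have "\<forall>x \<in> set p. g x \<notin> Y"
    using p(6) assms(3,4) by (metis order_less_asym)
  then have "empty_path r c (conf r c g Y) v p f"
    using p by (simp add: empty_path_def conf_def)
  then show ?thesis
    using f by blast
qed

text \<open>Keys fall in the order of arrival, so the loads already present have larger keys than
  the arriving one.\<close>

lemma run_stores:
  fixes s :: "nat \<Rightarrow> nat"
  assumes inj: "inj_on g (grid r c)"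
    and desc: "\<And>v. v \<in> grid r c \<Longrightarrow> fst v \<noteq> 0 \<Longrightarrow> \<exists>w \<in> grid r c. adjacent v w \<and> s (g w) < s (g v)"
    and "set ys \<subseteq> g ` grid r c" "sorted_wrt (\<lambda>x y. s y < s x) ys"
    and "\<And>z y. z \<in> Y \<Longrightarrow> y \<in> set ys \<Longrightarrow> s y < s z"
  shows "run r c (conf r c g Y) (map (\<lambda>l. Store l (inv_into (grid r c) g l)) ys)
    (conf r c g (Y \<union> set ys))"
  using assms(3-)
proof (induction ys arbitrary: Y)
  case (Cons y ys)
  obtain v where v: "v \<in> grid r c" "y = g v"
    using Cons.prems(1) by auto
  have inv: "inv_into (grid r c) g y = v"
    using inj v by simp
  have less: "s (g v) < s z" if "z \<in> Y" for z
    using Cons.prems(3) that v(2) by simp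
  then have "g v \<notin> Y"
    by blast
  then obtain f p where "f \<in> front r c" "empty_path r c (conf r c g Y) v p f"
    using ex_empty_path_conf[of r c s g, OF desc v(1)] less by blast
  \<comment> \<open>The descending path leads from \<open>v\<close> to the front; reversed, it is
    the way in.\<close>
  then have "f \<in> front r c" "empty_path r c (conf r c g Y) f (rev p) v"
    using empty_path_rev by blast+
  then have "step r c (conf r c g Y) (Store y v) (conf r c g (insert y Y))"
    using step.store conf_insert[OF inj v(1)] v(2) by metis
  moreover have "run r c (conf r c g (insert y Y))
      (map (\<lambda>l. Store l (inv_into (grid r c) g l)) ys) (conf r c g (insert y Y \<union> set ys))"
    using Cons.prems by (intro Cons.IH) auto
  ultimately show ?case
    using inv by auto
qed simp

lemma run_retrieves:
  assumes inj: "inj_on g (grid r c)"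
    and desc: "\<And>v. v \<in> grid r c \<Longrightarrow> fst v \<noteq> 0 \<Longrightarrow> \<exists>w \<in> grid r c. adjacent v w \<and> g w < g v"
    and "set ys \<subseteq> g ` grid r c" "sorted_wrt (<) ys"
  shows "run r c (conf r c g (set ys)) (map Retrieve ys) Map.empty"
  using assms(3-)
proof (induction ys)
  case Nil
  then show ?case
    by (simp add: conf_def)
next
  case (Cons y ys)
  obtain v where v: "v \<in> grid r c" "y = g v"
    using Cons.prems(1) by auto
  have "g v \<notin> set ys" and less: "\<And>z. z \<in> set ys \<Longrightarrow> g v < z"
    using Cons.prems(2) v(2) by auto
  then have del: "(conf r c g (set (y # ys)))(v := None) = conf r c g (set ys)"
    using conf_delete[OF inj v(1)] v(2) by simp
  obtain f p where "f \<in> front r c" "empty_path r c (conf r c g (set ys)) v p f"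
    using ex_empty_path_conf[of r c "\<lambda>x. x" g, OF desc v(1)] \<open>g v \<notin> set ys\<close> less by blast
  moreover have "conf r c g (set (y # ys)) v = Some y"
    using v by (simp add: conf_def)
  ultimately have "step r c (conf r c g (set (y # ys))) (Retrieve y) (conf r c g (set ys))"
    using step.retrieve[of "conf r c g (set (y # ys))" v y f r c p] del by simp
  then show ?case
    using Cons by auto
qed

lemma run_append: "run r c C (as @ bs) C' \<longleftrightarrow> (\<exists>C1. run r c C as C1 \<and> run r c C1 bs C')"
  by (induction as arbitrary: C) auto

lemma stored_retrieved_map:
  "stored (map (\<lambda>l. Store l (pos l)) ls) = ls" "retrieved (map (\<lambda>l. Store l (pos l)) ls) = []"
  "stored (map Retrieve ls) = []" "retrieved (map Retrieve ls) = ls"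
  by (induction ls) auto

lemma ex_key:
  assumes "distinct xs"
  shows "\<exists>s :: 'a \<Rightarrow> nat. inj_on s (set xs) \<and> sorted_wrt (\<lambda>x y. s y < s x) xs"
  using assms
proof (induction xs)
  case (Cons x xs)
  then obtain s :: "'a \<Rightarrow> nat" where s: "inj_on s (set xs)" "sorted_wrt (\<lambda>x y. s y < s x) xs"
    by auto
  \<comment> \<open>The new head gets a key above all others; \<open>insert 0\<close> covers the
    case of an empty \<open>xs\<close>.\<close>
  define t where "t = s(x := Suc (Max (insert 0 (s ` set xs))))"
  have eq: "t y = s y" "t y < t x" if "y \<in> set xs" for y
    using that Cons.prems by (auto simp: t_def less_Suc_eq_le)
  have "inj_on t (set xs)"
    using s(1) eq(1) by (simp add: inj_on_def)
  moreover have "sorted_wrt (\<lambda>x y. t y < t x) xs"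
    using s(2) eq(1) by (auto intro: sorted_wrt_mono_rel[rotated])
  ultimately have "inj_on t (set (x # xs)) \<and> sorted_wrt (\<lambda>x y. t y < t x) (x # xs)"
    using eq(2) by (fastforce simp: inj_on_insert)
  then show ?case
    by blast
qed simp

text \<open>Fewer than \<open>r * c\<close> loads are handled by letting the missing loads arrive and depart last.\<close>

lemma ex_relocation_free_solution:
  assumes "3 \<le> c" "n \<le> r * c" "distinct A" "set A = {1..n}"
  shows "\<exists>as. solution r c A [1..<Suc n] as \<and> relocation_free as \<and> length as = 2 * n"
proof -
  let ?B = "A @ [Suc n..<Suc (r * c)]"
  have "set [Suc n..<Suc (r * c)] = {Suc n..r * c}"
    by auto
  then have B: "distinct ?B" "set ?B = {1..r * c}"
    using assms(2-4) by (auto simp del: upt_Suc)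
  obtain s :: "nat \<Rightarrow> nat" where s: "inj_on s {1..r * c}" "sorted_wrt (\<lambda>x y. s y < s x) ?B"
    using ex_key[OF B(1)] unfolding B(2) by blast
  then have sA: "sorted_wrt (\<lambda>x y. s y < s x) A"
    unfolding sorted_wrt_append by blast
  obtain g where g: "filling s (grid r c) {1..r * c} g"
    using ex_filling[OF assms(1) _ _ s(1), of r] by auto
  then have inj: "inj_on g (grid r c)" and img: "g ` grid r c = {1..r * c}"
    and supp: "\<And>v. v \<in> grid r c \<Longrightarrow> supported s (grid r c) g v"
    by (auto simp: filling_def bij_betw_def)
  define S where "S = map (\<lambda>l. Store l (inv_into (grid r c) g l)) A"
  define R where "R = map Retrieve [1..<Suc n]"
  \<comment> \<open>The filling was built for \<open>r * c\<close> loads, but only those of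
    \<open>A\<close> are stored; the cells of the added loads stay empty.\<close>
  have "run r c (conf r c g {}) S (conf r c g ({} \<union> set A))"
    unfolding S_def
  proof (rule run_stores[OF inj _ _ sA])
    show "\<exists>w \<in> grid r c. adjacent v w \<and> s (g w) < s (g v)" if "v \<in> grid r c" "fst v \<noteq> 0" for v
      using supp[OF that(1)] that(2) by (auto simp: supported_def)
  qed (use assms(2,4) img in auto)
  moreover have "run r c (conf r c g (set [1..<Suc n])) R Map.empty"
    unfolding R_def
  proof (rule run_retrieves[OF inj])
    show "\<exists>w \<in> grid r c. adjacent v w \<and> g w < g v" if "v \<in> grid r c" "fst v \<noteq> 0" for v
      using supp[OF that(1)] that(2) by (auto simp: supported_def)
  qed (use assms(2) img in \<open>auto simp del: upt_Suc\<close>)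
  moreover have "{} \<union> set A = set [1..<Suc n]"
    by (simp add: assms(4) atLeastLessThanSuc_atLeastAtMost del: upt_Suc)
  moreover have "conf r c g {} = Map.empty"
    by (simp add: conf_def)
  ultimately have "run r c Map.empty (S @ R) Map.empty"
    unfolding run_append by metis
  moreover have "stored S = A" "retrieved S = []" "stored R = []" "retrieved R = [1..<Suc n]"
    by (simp_all only: S_def R_def stored_retrieved_map)
  ultimately have "solution r c A [1..<Suc n] (S @ R)"
    unfolding solution_def by blast
  moreover have "relocation_free (S @ R)"
    by (auto simp: relocation_free_def S_def R_def)
  moreover have "length A = n"
    using distinct_card[OF assms(3)] assms(4) by simp
  then have "length (S @ R) = 2 * n"
    by (simp add: S_def R_def)
  ultimately show ?thesis
    by blast
qed

section \<open>At most two columns\<close>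

inductive_cases step_StoreE: "step r c C (Store l v) C'"
inductive_cases step_RetrieveE: "step r c C (Retrieve l) C'"

lemma stores_only:
  assumes "relocation_free as" "retrieved as = []"
  shows "\<exists>lvs. as = map (case_prod Store) lvs \<and> stored as = map fst lvs"
  using assms
proof (induction as)
  case (Cons a as)
  then obtain l v where "a = Store l v"
    by (cases a) (auto simp: relocation_free_def)
  moreover obtain lvs where "as = map (case_prod Store) lvs \<and> stored as = map fst lvs"
    using Cons calculation by (auto simp: relocation_free_def)
  ultimately show ?case
    by (intro exI[of _ "(l, v) # lvs"]) auto
qed simp

lemma retrieves_only:
  assumes "relocation_free as" "stored as = []"
  shows "as = map Retrieve (retrieved as)"
  using assms
proof (induction as)
  case (Cons a as)
  then show ?case
    by (cases a) (auto simp: relocation_free_def)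
qed simp

lemma empty_pathD:
  assumes "empty_path r c C u p v"
  shows "u \<in> set p" "v \<in> set p" "set p \<subseteq> grid r c - dom C"
  using assms by (auto simp: empty_path_def)

text \<open>The count of occupied cells identifies the empty ones in a nearly full area, and the
  bound on \<open>ran\<close> shows that a load still to arrive is nowhere inside.\<close>

lemma run_stores_dom:
  assumes "run r c C (map (case_prod Store) lvs) C'" "dom C \<subseteq> grid r c"
  shows "dom C' \<subseteq> grid r c \<and> card (dom C') = card (dom C) + length lvs \<and>
    ran C' \<subseteq> ran C \<union> set (map fst lvs)"
  using assms
proof (induction lvs arbitrary: C)
  case (Cons lv lvs)
  obtain l v where lv: "lv = (l, v)"
    by (cases lv)
  obtain C1 where C1: "step r c C (Store l v) C1" "run r c C1 (map (case_prod Store) lvs) C'"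
    using Cons.prems(1) lv by auto
  from C1(1) obtain f p where p: "empty_path r c C f p v" "C1 = C(v \<mapsto> l)"
    by (rule step_StoreE) blast
  have v: "v \<in> grid r c" "v \<notin> dom C"
    using empty_pathD[OF p(1)] by auto
  have "finite (dom C)"
    using Cons.prems(2) by (rule finite_subset) (simp add: grid_def)
  then have "dom C1 \<subseteq> grid r c" "card (dom C1) = Suc (card (dom C))"
    using Cons.prems(2) v p(2) by auto
  moreover have "ran C1 \<subseteq> insert l (ran C)"
    using v(2) by (auto simp: p(2) ran_def)
  ultimately show ?case
    using Cons.IH[OF C1(2)] lv by auto
qed simp

text \<open>The last load finds a single empty cell \<open>v\<close>, so its path consists of
  \<open>v\<close> alone and \<open>v\<close> is in the front row. Load 1 then leaves a full area,
  where its path can use only its own cell \<open>u\<close>, so \<open>u\<close> is in the front row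
  too.\<close>

lemma full_solutionE:
  assumes "solution r c (A @ [n]) (1 # D) as" "relocation_free as"
    and "Suc (length A) = r * c" "n \<noteq> 1"
  obtains lvs C v u where "run r c Map.empty (map (case_prod Store) lvs) C" "map fst lvs = A"
    "dom C = grid r c - {v}" "v \<in> front r c" "u \<in> front r c" "u \<noteq> v" "C u = Some 1"
    "run r c (C(v \<mapsto> n, u := None)) (map Retrieve D) Map.empty"
proof -
  obtain S R where as: "as = S @ R" and S: "stored S = A @ [n]" "retrieved S = []"
    and R: "stored R = []" "retrieved R = 1 # D" and run: "run r c Map.empty (S @ R) Map.empty"
    using assms(1) unfolding solution_def by blast
  have "relocation_free S" "relocation_free R"
    using assms(2) as by (auto simp: relocation_free_def)
  then obtain kvs where kvs: "S = map (case_prod Store) kvs" "map fst kvs = A @ [n]"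
    and R_eq: "R = map Retrieve (1 # D)"
    using stores_only[of S] retrieves_only[of R] S R by auto
  obtain lvs v where lvs: "kvs = lvs @ [(n, v)]" "map fst lvs = A"
    using kvs(2) by (auto simp: map_eq_append_conv)
  obtain C C2 C3 where C: "run r c Map.empty (map (case_prod Store) lvs) C"
    and C2: "step r c C (Store n v) C2" and C3: "step r c C2 (Retrieve 1) C3"
    and D: "run r c C3 (map Retrieve D) Map.empty"
    using run unfolding kvs(1) lvs(1) R_eq by (auto simp: run_append)
  from C2 obtain f p where f: "f \<in> front r c" and p: "empty_path r c C f p v"
    and C2_eq: "C2 = C(v \<mapsto> n)"
    by (rule step_StoreE) blast
  have C_dom: "dom C \<subseteq> grid r c" "card (dom C) = length A"
    using run_stores_dom[OF C] lvs(2) by auto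
  have v: "v \<in> grid r c" "v \<notin> dom C"
    using empty_pathD[OF p] by auto
  have dom_C: "dom C = grid r c - {v}"
  proof (rule card_subset_eq)
    show "card (dom C) = card (grid r c - {v})"
      using C_dom v assms(3) by (simp add: grid_def card_cartesian_product)
  qed (use C_dom v in \<open>auto simp: grid_def\<close>)
  then have "set p \<subseteq> {v}"
    using empty_pathD(3)[OF p] by auto
  then have "f = v"
    using empty_pathD(1)[OF p] by auto
  from C3 obtain u f' q where u: "C2 u = Some 1" and f': "f' \<in> front r c"
    and q: "empty_path r c (C2(u := None)) u q f'" and C3_eq: "C3 = C2(u := None)"
    by (rule step_RetrieveE) blast
  have "set q \<subseteq> {u}"
    using empty_pathD(3)[OF q] dom_C by (auto simp: C2_eq)
  then have "f' = u"
    using empty_pathD(2)[OF q] by auto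
  have "u \<noteq> v"
    using u C2_eq assms(4) by auto
  show thesis
    using that[OF C lvs(2) dom_C _ _ \<open>u \<noteq> v\<close>] f f' u D \<open>f = v\<close> \<open>f' = u\<close> \<open>u \<noteq> v\<close>
    by (simp add: C2_eq C3_eq)
qed

text \<open>No cell is adjacent to itself, so the second cell of the path can only be
  \<open>v\<close>.\<close>

lemma path_two_cells_adjacent:
  assumes "successively adjacent p" "p \<noteq> []" "hd p = u" "last p = v" "set p \<subseteq> {u, v}" "u \<noteq> v"
  shows "adjacent u v"
  using assms
proof (induction p)
  case (Cons a p)
  then have p: "p \<noteq> []" "a = u" "adjacent u (hd p)"
    by (auto simp: successively_Cons)
  have "hd p \<in> set p"
    using p(1) by simp
  then have "hd p \<in> {u, v}"
    using Cons.prems(5) by auto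
  moreover have "hd p \<noteq> u"
    using p(3) by (cases u) auto
  ultimately show ?case
    using p(3) by auto
qed simp

text \<open>The last load \<open>r\<close> and load 1 would need two different front cells, but
  there is only one.\<close>

lemma one_column_unsolvable:
  assumes "1 < r" "solution r 1 [1..<Suc r] [1..<Suc r] as" "relocation_free as"
  shows False
proof -
  have "[1..<Suc r] = [1..<r] @ [r]" "[1..<Suc r] = 1 # [2..<Suc r]"
    using assms(1) upt_conv_Cons[of 1 "Suc r"] by (auto simp: numeral_2_eq_2)
  then have "solution r 1 ([1..<r] @ [r]) (1 # [2..<Suc r]) as"
    using assms(2) by metis
  then obtain u v where "u \<in> front r 1" "v \<in> front r 1" "u \<noteq> v"
    by (rule full_solutionE[OF _ assms(3)]) (use assms(1) in auto)
  then show False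
    by (auto simp: front_def grid_def)
qed

text \<open>At the end of the storage phase the front row consists of loads 1 and \<open>2 * r\<close>, so load 2 has
  to stand behind load 1. But when load 2 arrives, only its own cell and the other front cell are
  empty, and these are not adjacent.\<close>

lemma two_columns_unsolvable:
  assumes "1 < r" "solution r 2 (1 # [3..<2 * r] @ [2, 2 * r]) [1..<Suc (2 * r)] as"
    and "relocation_free as"
  shows False
proof -
  have "[1..<Suc (2 * r)] = 1 # 2 # [3..<Suc (2 * r)]"
    using assms(1) upt_conv_Cons[of 1 "Suc (2 * r)"] upt_conv_Cons[of 2 "Suc (2 * r)"]
    by (simp add: eval_nat_numeral)
  then have "solution r 2 ((1 # [3..<2 * r] @ [2]) @ [2 * r]) (1 # 2 # [3..<Suc (2 * r)]) as"
    using assms(2) by simp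
  then obtain lvs C v u where C: "run r 2 Map.empty (map (case_prod Store) lvs) C"
      "map fst lvs = 1 # [3..<2 * r] @ [2]" and dom_C: "dom C = grid r 2 - {v}"
    and uv: "v \<in> front r 2" "u \<in> front r 2" "u \<noteq> v" and u1: "C u = Some 1"
    and D: "run r 2 (C(v \<mapsto> 2 * r, u := None)) (map Retrieve (2 # [3..<Suc (2 * r)])) Map.empty"
    by (rule full_solutionE[OF _ assms(3)]) (use assms(1) in auto)
  have front: "front r 2 = {u, v}"
    using uv by (auto simp: front_def grid_def)
  have "map fst lvs = (1 # [3..<2 * r]) @ [2]"
    using C(2) by simp
  then obtain kvs w where kvs: "lvs = kvs @ [(2, w)]" "map fst kvs = 1 # [3..<2 * r]"
    unfolding map_eq_append_conv by auto
  obtain C0 where C0: "run r 2 Map.empty (map (case_prod Store) kvs) C0"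
    and "step r 2 C0 (Store 2 w) C"
    using C(1) by (auto simp: kvs(1) run_append)
  from this(2) obtain f p where f: "f \<in> front r 2" and p: "empty_path r 2 C0 f p w"
    and C_eq: "C = C0(w \<mapsto> 2)"
    by (rule step_StoreE) blast
  \<comment> \<open>Load 2 is not among the earlier arrivals, so \<open>w\<close> is the only cell
    that can hold it.\<close>
  have "2 \<notin> ran C0"
    using run_stores_dom[OF C0] kvs(2) by auto
  then have C_2: "x = w" if "C x = Some 2" for x
    using that ranI[of C0 x 2] by (auto simp: C_eq split: if_splits)
  have "w \<noteq> v"
    using dom_C by (auto simp: C_eq)
  have "w \<noteq> u"
    using u1 by (auto simp: C_eq)
  have dom_C0: "dom C0 = grid r 2 - {v, w}"
    using dom_C empty_pathD(2,3)[OF p] \<open>w \<noteq> v\<close> by (auto simp: C_eq)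
  \<comment> \<open>The other front cell \<open>u\<close> already holds load 1, so load 2 must enter
    through \<open>v\<close>.\<close>
  have "f = v"
    using f front empty_pathD(1,3)[OF p] dom_C0 \<open>w \<noteq> u\<close> \<open>u \<noteq> v\<close> by auto
  have "set p \<subseteq> {v, w}"
    using empty_pathD(3)[OF p] dom_C0 by auto
  then have vw: "adjacent v w"
    using path_two_cells_adjacent[of p v w] p \<open>f = v\<close> \<open>w \<noteq> v\<close> by (auto simp: empty_path_def)
  obtain C4 where "step r 2 (C(v \<mapsto> 2 * r, u := None)) (Retrieve 2) C4"
    using D by auto
  then obtain x f' q where x: "(C(v \<mapsto> 2 * r, u := None)) x = Some 2" and f': "f' \<in> front r 2"
    and q: "empty_path r 2 (C(v \<mapsto> 2 * r, u := None, x := None)) x q f'"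
    by (rule step_RetrieveE) blast
  have "x = w"
    using x assms(1) C_2 by (auto split: if_splits)
  \<comment> \<open>After load 1 has left, \<open>u\<close> is the only empty cell besides the one
    that load 2 vacates, so load 2 leaves through \<open>u\<close>.\<close>
  have "set q \<subseteq> {w, u}"
    using empty_pathD(3)[OF q] dom_C \<open>x = w\<close> by auto
  moreover have "f' = u"
    using f' front empty_pathD(2)[OF q] calculation \<open>w \<noteq> v\<close> \<open>u \<noteq> v\<close> by auto
  ultimately have wu: "adjacent w u"
    using path_two_cells_adjacent[of q w u] q \<open>x = w\<close> \<open>w \<noteq> u\<close> by (auto simp: empty_path_def)
  have "w \<in> grid r 2"
    using empty_pathD(2,3)[OF p] by auto
  moreover have "w \<notin> front r 2"
    using front \<open>w \<noteq> u\<close> \<open>w \<noteq> v\<close> by simp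
  ultimately have "fst w \<noteq> 0"
    by (simp add: front_def)
  moreover have "fst u = 0" "fst v = 0"
    using uv by (auto simp: front_def)
  \<comment> \<open>A cell behind the front row touches the front only in its own column, so
    \<open>w\<close> cannot be adjacent to both \<open>u\<close> and \<open>v\<close>.\<close>
  moreover have "snd x = snd w" if "adjacent x w" "fst x = 0" "fst w \<noteq> 0" for x
    using that by (cases x; cases w) auto
  ultimately have "snd u = snd v"
    using vw wu adjacent_sym[of w u] by metis
  then show False
    using \<open>fst u = 0\<close> \<open>fst v = 0\<close> \<open>u \<noteq> v\<close> by (simp add: prod_eq_iff)
qed

theorem theorem2:
  fixes r c :: nat
  assumes "r > 1" and "c \<ge> 1"
  shows "(\<forall>n A. n \<le> r * c \<and> distinct A \<and> set A = {1..n} \<longrightarrow>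
            (\<exists>as. solution r c A [1..<Suc n] as \<and> relocation_free as \<and> length as = 2 * n))
         \<longleftrightarrow> c \<ge> 3"
proof
  assume solvable: "\<forall>n A. n \<le> r * c \<and> distinct A \<and> set A = {1..n} \<longrightarrow>
    (\<exists>as. solution r c A [1..<Suc n] as \<and> relocation_free as \<and> length as = 2 * n)"
  have "c \<noteq> 1"
  proof
    assume "c = 1"
    moreover have "distinct [1..<Suc r]" "set [1..<Suc r] = {1..r}"
      by (simp, auto)
    ultimately obtain as where "solution r 1 [1..<Suc r] [1..<Suc r] as" "relocation_free as"
      using solvable by (metis mult.right_neutral order_refl)
    then show False
      by (rule one_column_unsolvable[OF assms(1)])
  qed
  moreover have "c \<noteq> 2"
  proof
    assume "c = 2"
    \<comment> \<open>Load 2 arrives just before the last load and departs just after load 1, so its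
      ways in and out are forced through different front cells.\<close>
    let ?A = "1 # [3..<2 * r] @ [2, 2 * r]"
    have "distinct ?A" "set ?A = {1..2 * r}"
      using assms(1) by auto
    then obtain as where "solution r 2 ?A [1..<Suc (2 * r)] as" "relocation_free as"
      using solvable \<open>c = 2\<close> by (metis mult.commute order_refl)
    then show False
      by (rule two_columns_unsolvable[OF assms(1)])
  qed
  ultimately show "c \<ge> 3"
    using assms(2) by simp
next
  assume "c \<ge> 3"
  then show "\<forall>n A. n \<le> r * c \<and> distinct A \<and> set A = {1..n} \<longrightarrow>
    (\<exists>as. solution r c A [1..<Suc n] as \<and> relocation_free as \<and> length as = 2 * n)"
    using ex_relocation_free_solution by blast
qed

end
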